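(* For every integer $n\ge 1$, the number $a^C(S_{n+1})$ of assembly trees satisfying the connected gluing rule for the star graph $S_{n+1}$ on $n+1$ vertices is $$a^C(S_{n+1})=\sum_{k=1}^{n}k!\,S_2(n,k),$$ where $S_2(n,k)$ denotes the Stirling number of the second kind.
   Context: All graphs are finite and simple. Let $G=(V,E)$ be a connected graph with $|V|=N$. An assembly tree for $G$ is a rooted (unordered) tree each of whose nodes is labeled by a subset $U\subseteq V$ such that: (1) the label of the root is $V$; (2) each internal node $U$ has at least two children, and $U$ is the union of the labels of its children; (3) there are exactly $N$ leaves, labeled by the $N$ vertices of $G$ respectively (a vertex $v$ being identified with $\{v\}$). Two assembly trees are the same if there is a label-preserving isomorphism of rooted trees between them. An assembly tree satisfies the connected gluing rule if for each internal node, the subgraph of $G$ induced by the vertices in its label is connected. $a^C(G)$ denotes the number of assembly trees for $G$ satisfying the connected gluing rule. The star graph $S_{n+1}$ has one center vertex (labeled $0$) and $n$ other vertices (labeled $1,\dots,n$), each adjacent to the center only. $S_2(n,k)$ (Stirling number) is not to be confused with the star graph notation. *)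

theory Defs
  imports "HOL-Library.Multiset" "HOL-Combinatorics.Stirling" "Graph_Theory.Graph_Theory"
begin

text \<open>
  Finite simple graphs are the symmetric, loop-free, finite digraphs without parallel arcs
  (locale \<^locale>\<open>graph\<close>): an undirected edge is a pair of opposite arcs.
\<close>

text \<open>
  Finite rooted unordered trees with labelled nodes. The children of a node form a multiset, so
  two values of this type are equal iff there is a label-preserving isomorphism of rooted trees
  between them; hence counting values is counting trees up to such isomorphisms.
\<close>

datatype 'l ltree = Node (label: 'l) (children: "'l ltree multiset")

text \<open>One entry per node of the tree, namely the subtree rooted at that node.\<close>

primrec subtrees :: "'l ltree \<Rightarrow> 'l ltree multiset" where
  "subtrees (Node U ts) = add_mset (Node U ts) (\<Sum>\<^sub># (image_mset subtrees ts))"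

definition is_leaf :: "'l ltree \<Rightarrow> bool" where
  "is_leaf t \<longleftrightarrow> children t = {#}"

definition leaf_labels :: "'l ltree \<Rightarrow> 'l multiset" where
  "leaf_labels t = image_mset label (filter_mset is_leaf (subtrees t))"

text \<open>
  The last conjunct compares multisets: each vertex labels exactly one leaf, and there are no
  other leaves.
\<close>

definition assembly_tree :: "('v, 'e) pre_digraph \<Rightarrow> 'v set ltree \<Rightarrow> bool" where
  "assembly_tree G t \<longleftrightarrow>
     (\<forall>s \<in># subtrees t. label s \<subseteq> verts G) \<and>
     label t = verts G \<and>
     (\<forall>s \<in># subtrees t. \<not> is_leaf s \<longrightarrow>
        2 \<le> size (children s) \<and> label s = (\<Union>c \<in> set_mset (children s). label c)) \<and>
     leaf_labels t = image_mset (\<lambda>v. {v}) (mset_set (verts G))"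

definition connected_gluing :: "('v, 'e) pre_digraph \<Rightarrow> 'v set ltree \<Rightarrow> bool" where
  "connected_gluing G t \<longleftrightarrow>
     (\<forall>s \<in># subtrees t. \<not> is_leaf s \<longrightarrow> Digraph_Component.connected (G \<restriction> label s))"

definition num_assembly_trees_connected :: "('v, 'e) pre_digraph \<Rightarrow> nat" where
  "num_assembly_trees_connected G = card {t. assembly_tree G t \<and> connected_gluing G t}"

text \<open>The index is the number of vertices; the vertex 0 is the centre.\<close>

definition star_graph :: "nat \<Rightarrow> nat pair_pre_digraph" where
  "star_graph m = \<lparr> pverts = {0..<m}, parcs = {0} \<times> {1..<m} \<union> {1..<m} \<times> {0} \<rparr>"

lemma pair_graph_star: "pair_graph (star_graph (n + 1))"
proof
  show "symmetric (with_proj (star_graph (n + 1)))"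
    unfolding symmetric_def by (auto simp: star_graph_def intro: symI)
qed (auto simp: star_graph_def)

lemma graph_star: "graph (with_proj (star_graph (n + 1)))"
proof -
  interpret pair_graph "star_graph (n + 1)" by (rule pair_graph_star)
  show ?thesis by unfold_locales
qed

lemma connected_star: "Digraph_Component.connected (with_proj (star_graph (n + 1)))"
proof -
  interpret G: graph "with_proj (star_graph (n + 1))" by (rule graph_star)
  let ?G = "with_proj (star_graph (n + 1))"
  have arc: "0 \<rightarrow>\<^bsub>?G\<^esub> v" "v \<rightarrow>\<^bsub>?G\<^esub> 0" if "v \<in> verts ?G" "v \<noteq> 0" for v
    using that by (auto simp: star_graph_def)
  have zero: "0 \<in> verts ?G" by (simp add: star_graph_def)
  have "0 \<rightarrow>\<^sup>*\<^bsub>?G\<^esub> v \<and> v \<rightarrow>\<^sup>*\<^bsub>?G\<^esub> 0" if "v \<in> verts ?G" for v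
  proof (cases "v = 0")
    case True
    then show ?thesis using G.reachable_refl[OF zero] by (simp del: One_nat_def)
  next
    case False
    then show ?thesis using arc[OF that] by (blast intro: G.reachable_adjI)
  qed
  then have to: "0 \<rightarrow>\<^sup>*\<^bsub>?G\<^esub> v" "v \<rightarrow>\<^sup>*\<^bsub>?G\<^esub> 0" if "v \<in> verts ?G" for v
    using that by blast+
  have "verts ?G \<noteq> {}" using zero by blast
  moreover have "u \<rightarrow>\<^sup>*\<^bsub>mk_symmetric ?G\<^esub> v" if "u \<in> verts ?G" "v \<in> verts ?G" for u v
    using that to by (blast intro: G.reachable_mk_symmetricI G.reachable_trans)
  ultimately show ?thesis by (rule G.connectedI)
qed

end

theory Submission
  imports Defs
begin

text \<open>
  A set of at least two vertices of the star induces a connected subgraph iff it contains the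
  centre (\<open>connected_induced_star\<close>), because all edges meet the centre. In an assembly tree
  every label is the disjoint union of the leaf labels below it, so an internal node has at least
  two vertices in its label, and the connected gluing rule says that every internal label contains
  the centre. As siblings have disjoint labels, at most one child of a node is then internal:
  the tree is a chain of gluing steps, each of which attaches a nonempty set of single vertices
  to the part containing the centre.

  Such a chain with \<open>k\<close> steps is recorded by the function sending each non-central vertex to the
  number of the step at which it is attached. Every step attaches something, so this is a
  surjection from \<open>{1..n}\<close> onto \<open>{..<k}\<close>, and every surjection arises from exactly one tree
  (\<open>centred_tree_is_chain_tree\<close>, \<open>centred_tree_chain_tree\<close>, \<open>chain_tree_inject\<close>). There are
  \<open>k! S(n, k)\<close> of them (\<open>card_surjections\<close>); summing over \<open>k\<close> gives the formula.
\<close>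

section \<open>Counting surjections\<close>

text \<open>
  The functions are extensional, that is \<^const>\<open>undefined\<close> outside the domain, so that each
  surjection between the two sets is represented once.
\<close>

definition surjections :: "'a set \<Rightarrow> 'b set \<Rightarrow> ('a \<Rightarrow> 'b) set" where
  "surjections A B = {f \<in> A \<rightarrow>\<^sub>E B. f ` A = B}"

lemma finite_surjections: "finite A \<Longrightarrow> finite B \<Longrightarrow> finite (surjections A B)"
  unfolding surjections_def by (rule finite_subset[OF _ finite_PiE]) auto

text \<open>
  Removing \<open>a\<close> from the domain of a surjection leaves a function that is still onto, or misses
  only the value at \<open>a\<close>. This is the combinatorial content of the Stirling recurrence.
\<close>

lemma surjections_insert:
  assumes "a \<notin> A"
  shows "surjections (insert a A) B =
    (\<lambda>(b, g). g(a := b)) ` (SIGMA b:B. surjections A B \<union> surjections A (B - {b}))"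
    (is "?L = ?h ` ?R")
proof (intro equalityI subsetI)
  fix f assume "f \<in> ?L"
  then have f: "f \<in> insert a A \<rightarrow>\<^sub>E B" and im: "f ` insert a A = B"
    by (auto simp: surjections_def)
  define g where "g = f(a := undefined)"
  have gA: "g ` A = f ` A" and ext: "g \<in> extensional A"
    using assms f by (auto simp: g_def extensional_def PiE_iff)
  then have "g \<in> surjections A (f ` A)" by (auto simp: surjections_def PiE_iff)
  moreover have "f ` A = B \<or> f ` A = B - {f a}"
    using im by (cases "f a \<in> f ` A") (auto simp: insert_absorb image_iff)
  ultimately have "g \<in> surjections A B \<union> surjections A (B - {f a})"
    by (metis UnI1 UnI2)
  moreover have "f a \<in> B" using im by blast
  ultimately have "(f a, g) \<in> ?R" by blast
  moreover have "f = ?h (f a, g)" by (auto simp: g_def)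
  ultimately show "f \<in> ?h ` ?R" by blast
next
  fix f assume "f \<in> ?h ` ?R"
  then obtain b g where b: "b \<in> B" and g: "g \<in> surjections A B \<union> surjections A (B - {b})"
    and f: "f = g(a := b)" by auto
  have "g \<in> A \<rightarrow>\<^sub>E B" and im: "insert b (g ` A) = B"
    using b g by (auto simp: surjections_def PiE_iff)
  then have "f \<in> insert a A \<rightarrow>\<^sub>E B"
    unfolding f using b by (intro PiE_fun_upd) auto
  moreover have "f ` A = g ` A" unfolding f using assms by (intro image_cong) auto
  moreover have "f a = b" by (simp add: f)
  ultimately have "f \<in> insert a A \<rightarrow>\<^sub>E B" "f ` insert a A = B" using im by simp_all
  then show "f \<in> ?L" by (simp add: surjections_def)
qed

text \<open>
  By \<open>surjections_insert\<close> the cardinalities \<open>c(m, k)\<close> satisfy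
  \<open>c(m + 1, k) = k (c(m, k) + c(m, k - 1))\<close>, which is the recurrence of \<^const>\<open>Stirling\<close>
  multiplied by \<open>k!\<close>. The codomain varies in the induction because it loses a point.
\<close>

lemma card_surjections:
  assumes "finite A" "finite B"
  shows "card (surjections A B) = fact (card B) * Stirling (card A) (card B)"
  using assms
proof (induction A arbitrary: B rule: finite_induct)
  case empty
  show ?case
  proof (cases "B = {}")
    case False
    then obtain m where "card B = Suc m" using empty by (cases "card B") auto
    with False show ?thesis by (auto simp: surjections_def)
  qed (simp add: surjections_def)
next
  case (insert a A)
  let ?h = "\<lambda>(b, g). g(a := b)"
  let ?R = "SIGMA b:B. surjections A B \<union> surjections A (B - {b})"
  have undef: "g a = undefined" if "g \<in> surjections A C" for g and C :: "'b set"
    using that insert.hyps by (auto simp: surjections_def PiE_iff extensional_def)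
  have "inj_on ?h ?R"
  proof (rule inj_onI, clarify)
    fix b g b' g'
    assume g: "g \<in> surjections A B \<union> surjections A (B - {b})"
      and g': "g' \<in> surjections A B \<union> surjections A (B - {b'})"
      and eq: "g(a := b) = g'(a := b')"
    (* Both restrictions take the default value at a, so overwriting it loses no information. *)
    have "g a = g' a" using g g' undef by (metis Un_iff)
    then show "b = b' \<and> g = g'" using eq by (metis fun_upd_same fun_upd_triv fun_upd_upd)
  qed
  then have "card (surjections (insert a A) B) = card ?R"
    unfolding surjections_insert[OF insert.hyps(2)] by (rule card_image)
  also have "\<dots> = (\<Sum>b\<in>B. card (surjections A B \<union> surjections A (B - {b})))"
    using insert finite_surjections by (intro card_SigmaI) auto
  also have "\<dots> = (\<Sum>b\<in>B. card (surjections A B) + card (surjections A (B - {b})))"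
    using insert
    by (intro sum.cong refl card_Un_disjoint finite_surjections) (auto simp: surjections_def)
  also have "\<dots> = fact (card B) * Stirling (card (insert a A)) (card B)"
    using insert by (cases "card B") (simp_all add: algebra_simps)
  finally show ?case .
qed

section \<open>Leaf labels of subtrees\<close>

lemma self_in_subtrees: "t \<in># subtrees t"
  by (cases t) auto

lemma leaf_labels_Node:
  "leaf_labels (Node U ts) = (if ts = {#} then {#U#} else \<Sum>\<^sub># (image_mset leaf_labels ts))"
proof -
  have "image_mset label (filter_mset is_leaf (\<Sum>\<^sub># (image_mset subtrees ts))) =
      \<Sum>\<^sub># (image_mset leaf_labels ts)"
    by (induction ts) (auto simp: leaf_labels_def)
  then show ?thesis by (auto simp: leaf_labels_def is_leaf_def)
qed

lemma subtrees_subtree: "s \<in># subtrees t \<Longrightarrow> subtrees s \<subseteq># subtrees t"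
proof (induction t)
  case (Node U ts)
  show ?case
  proof (cases "s = Node U ts")
    case False
    then obtain d where d: "d \<in># ts" "s \<in># subtrees d" using Node.prems by auto
    then obtain ts' where ts: "ts = add_mset d ts'" by (meson mset_add)
    have "subtrees (Node U ts) = subtrees d + add_mset (Node U ts) (\<Sum>\<^sub># (image_mset subtrees ts'))"
      by (simp add: ts)
    then have "subtrees d \<subseteq># subtrees (Node U ts)" by (metis mset_subset_eq_add_left)
    with Node.IH[OF d] show ?thesis by (rule subset_mset.order_trans)
  qed simp
qed

lemma leaf_labels_subtree: "s \<in># subtrees t \<Longrightarrow> leaf_labels s \<subseteq># leaf_labels t"
  unfolding leaf_labels_def
  by (intro image_mset_subseteq_mono multiset_filter_mono subtrees_subtree)

lemma leaf_labels_nonempty: "leaf_labels t \<noteq> {#}"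
proof (induction t)
  case (Node U ts)
  then show ?case by (auto simp: leaf_labels_Node)
qed

text \<open>
  The gluing condition is local, relating a node to its children; this global form lets
  statements about labels be read off from the multiset of leaf labels.
\<close>

lemma label_eq_Union_leaf_labels:
  assumes "\<forall>s \<in># subtrees t. \<not> is_leaf s \<longrightarrow> label s = (\<Union>d \<in> set_mset (children s). label d)"
  shows "label t = \<Union> (set_mset (leaf_labels t))"
  using assms
proof (induction t)
  case (Node U ts)
  show ?case
  proof (cases "ts = {#}")
    case False
    have "label d = \<Union> (set_mset (leaf_labels d))" if "d \<in># ts" for d
      using Node that by auto
    then show ?thesis using False Node.prems by (auto simp: is_leaf_def leaf_labels_Node)
  qed (simp add: leaf_labels_Node)
qed

abbreviation singletons :: "'v set \<Rightarrow> 'v set multiset" where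
  "singletons V \<equiv> image_mset (\<lambda>v. {v}) (mset_set V)"

lemma eq_mset_set_set_mset:
  assumes "\<And>x. count X x \<le> 1"
  shows "X = mset_set (set_mset X)"
proof (rule multiset_eqI)
  fix x
  show "count X x = count (mset_set (set_mset X)) x"
  proof (cases "x \<in># X")
    case True
    then have "count X x > 0" by simp
    then have "count X x = 1" using assms[of x] by linarith
    with True show ?thesis by (simp add: count_mset_set')
  qed (simp add: count_mset_set' not_in_iff)
qed

text \<open>
  As every vertex labels exactly one leaf, distributing the leaves among subtrees partitions the
  vertex set. This is how disjointness of sibling labels is obtained.
\<close>

lemma singletons_eq_plusD:
  assumes "finite V" "singletons V = M + N"
  obtains P Q where "V = P \<union> Q" "P \<inter> Q = {}" "M = singletons P" "N = singletons Q"
proof -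
  obtain M' N' where V: "mset_set V = M' + N'"
    and MN: "M = image_mset (\<lambda>v. {v}) M'" "N = image_mset (\<lambda>v. {v}) N'"
    using image_mset_eq_plusD[OF assms(2)] by blast
  have set: "V = set_mset M' \<union> set_mset N'"
    using arg_cong[OF V, of set_mset] assms(1) by simp
  have count: "count M' x + count N' x \<le> 1" for x
  proof -
    have "count M' x + count N' x = count (mset_set V) x" using V by simp
    then show ?thesis by (simp add: count_mset_set')
  qed
  have M': "M' = mset_set (set_mset M')" and N': "N' = mset_set (set_mset N')"
    using count by (intro eq_mset_set_set_mset; meson add_leE)+
  have "set_mset M' \<inter> set_mset N' = {}"
  proof (rule ccontr)
    assume "set_mset M' \<inter> set_mset N' \<noteq> {}"
    then obtain x where "count M' x > 0" "count N' x > 0" by auto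
    with count[of x] show False by linarith
  qed
  moreover have "M = singletons (set_mset M')" "N = singletons (set_mset N')"
    unfolding MN M'[symmetric] N'[symmetric] by (rule refl)+
  ultimately show thesis using set that by blast
qed

section \<open>Trees that grow around a central vertex\<close>

text \<open>
  The assembly trees on their own vertex set whose internal labels all contain \<open>c\<close>. Taking
  the vertex set from the root label makes the property inherited by the children containing
  \<open>c\<close>, as the induction in \<open>centred_tree_is_chain_tree\<close> needs.
\<close>

definition centred_tree :: "'v \<Rightarrow> 'v set ltree \<Rightarrow> bool" where
  "centred_tree c t \<longleftrightarrow>
     (\<forall>s \<in># subtrees t. \<not> is_leaf s \<longrightarrow> 2 \<le> size (children s) \<and>
        label s = (\<Union>d \<in> set_mset (children s). label d) \<and> c \<in> label s) \<and>
     finite (label t) \<and> leaf_labels t = singletons (label t)"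

text \<open>
  The number \<open>f x\<close> is the step at which \<open>x\<close> is glued to the part containing \<open>c\<close>. The root
  performs the last step \<open>k - 1\<close>; the subtree below it uses the same \<open>f\<close> on the vertices
  attached earlier.
\<close>

primrec chain_tree :: "'v \<Rightarrow> ('v \<Rightarrow> nat) \<Rightarrow> nat \<Rightarrow> 'v set \<Rightarrow> 'v set ltree" where
  "chain_tree c f 0 A = Node {c} {#}"
| "chain_tree c f (Suc k) A = Node (insert c A)
     (add_mset (chain_tree c f k {x \<in> A. f x < k})
       (image_mset (\<lambda>v. Node {v} {#}) (mset_set {x \<in> A. f x = k})))"

lemma chain_tree_cong:
  "(\<And>x. x \<in> A \<Longrightarrow> f x = g x) \<Longrightarrow> chain_tree c f k A = chain_tree c g k A"
proof (induction k arbitrary: A)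
  case (Suc k)
  have "chain_tree c f k {x \<in> A. f x < k} = chain_tree c g k {x \<in> A. f x < k}"
    using Suc.prems by (intro Suc.IH) auto
  moreover have "{x \<in> A. f x < k} = {x \<in> A. g x < k}" "{x \<in> A. f x = k} = {x \<in> A. g x = k}"
    using Suc.prems by auto
  ultimately show ?case by simp
qed simp

text \<open>
  Only one child of the root can contain \<open>c\<close>, by disjointness, so all other children are leaves.
  The induction hypothesis numbers the steps inside that child by \<open>{..<k}\<close>, and the vertices on
  the leaves get the next number \<open>k\<close>. There is at least one such leaf because the root has at
  least two children, so the extended numbering is again onto an initial segment.
\<close>

lemma centred_tree_is_chain_tree:
  assumes "centred_tree c t" "c \<in> label t"
  shows "\<exists>k f. f ` (label t - {c}) = {..<k} \<and> t = chain_tree c f k (label t - {c})"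
  using assms
proof (induction t)
  case (Node U ts)
  note ct = Node.prems(1)[unfolded centred_tree_def]
  have fin: "finite U" and leaves: "leaf_labels (Node U ts) = singletons U" using ct by simp_all
  show ?case
  proof (cases "ts = {#}")
    case True
    then have "{#U#} = singletons U" using leaves by (simp add: leaf_labels_Node)
    then have "size {#U#} = size (singletons U)" by (rule arg_cong)
    then have "card U = 1" by simp
    then have "U = {c}" using Node.prems(2) by (auto simp: card_1_singleton_iff)
    then show ?thesis using True by (auto intro!: exI[of _ 0])
  next
    case False
    then have size: "2 \<le> size ts" and U: "U = (\<Union>d \<in> set_mset ts. label d)"
      using ct by (auto simp: is_leaf_def)
    then obtain t' where t': "t' \<in># ts" "c \<in> label t'" using Node.prems(2) by auto
    then obtain rest where ts: "ts = add_mset t' rest" by (meson mset_add)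
    have "singletons U = leaf_labels t' + \<Sum>\<^sub># (image_mset leaf_labels rest)"
      using leaves by (simp add: leaf_labels_Node ts)
    (* P is the part already assembled around c, Q the set of vertices attached at the root. *)
    with fin obtain P Q where PQ: "U = P \<union> Q" "P \<inter> Q = {}"
      and P: "leaf_labels t' = singletons P"
      and Q: "\<Sum>\<^sub># (image_mset leaf_labels rest) = singletons Q"
      by (rule singletons_eq_plusD)
    have finPQ: "finite P" "finite Q" using fin PQ by auto
    have lab: "label d = \<Union> (set_mset (leaf_labels d))" if "d \<in># ts" for d
      using ct that by (intro label_eq_Union_leaf_labels) auto
    have labP: "label t' = P" using lab[OF t'(1)] P finPQ by simp
    have leafQ: "is_leaf d" if d: "d \<in># rest" for d
    proof (rule ccontr)
      assume "\<not> is_leaf d"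
      then have "c \<in> label d" using ct d ts self_in_subtrees by fastforce
      moreover have "set_mset (leaf_labels d) \<subseteq> set_mset (\<Sum>\<^sub># (image_mset leaf_labels rest))"
        using d by auto
      then have "label d \<subseteq> Q" using lab[of d] d finPQ unfolding Q ts by auto
      ultimately show False using PQ(2) labP t'(2) by blast
    qed
    have "image_mset leaf_labels rest = image_mset (\<lambda>d. {#label d#}) rest"
    proof (rule image_mset_cong)
      fix d assume "d \<in># rest"
      from leafQ[OF this] show "leaf_labels d = {#label d#}"
        by (cases d) (simp add: is_leaf_def leaf_labels_Node)
    qed
    then have labQ: "image_mset label rest = singletons Q" using Q by simp
    have "rest = image_mset (\<lambda>d. Node (label d) {#}) rest"
    proof -
      have "image_mset (\<lambda>d. d) rest = image_mset (\<lambda>d. Node (label d) {#}) rest"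
      proof (rule image_mset_cong)
        fix d assume "d \<in># rest"
        from leafQ[OF this] show "d = Node (label d) {#}"
          by (cases d) (simp add: is_leaf_def)
      qed
      then show ?thesis by simp
    qed
    also have "\<dots> = image_mset (\<lambda>V. Node V {#}) (image_mset label rest)"
      by (simp add: multiset.map_comp o_def)
    also have "\<dots> = image_mset (\<lambda>v. Node {v} {#}) (mset_set Q)"
      by (simp add: labQ multiset.map_comp o_def)
    finally have rest: "rest = image_mset (\<lambda>v. Node {v} {#}) (mset_set Q)" .
    have Q_ne: "Q \<noteq> {}" using size ts rest by auto
    have "centred_tree c t'"
    proof -
      have "s \<in># subtrees (Node U ts)" if "s \<in># subtrees t'" for s using t'(1) that by auto
      with ct show ?thesis
        unfolding centred_tree_def labP P using finPQ(1) by blast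
    qed
    from Node.IH[OF t'(1) this t'(2)] obtain k f
      where f: "f ` (P - {c}) = {..<k}" and t'_eq: "t' = chain_tree c f k (P - {c})"
      unfolding labP by blast
    define g where "g x = (if x \<in> Q then k else f x)" for x
    have cP: "c \<in> P" using t'(2) labP by simp
    have U_minus: "U - {c} = (P - {c}) \<union> Q" using PQ cP by blast
    have gP: "g x = f x" "f x < k" if "x \<in> P - {c}" for x
      using that PQ(2) f by (auto simp: g_def)
    have gQ: "g x = k" if "x \<in> Q" for x using that by (simp add: g_def)
    have below: "{x \<in> U - {c}. g x < k} = P - {c}"
      unfolding U_minus using gP gQ by auto
    have at: "{x \<in> U - {c}. g x = k} = Q"
      unfolding U_minus using gP gQ by fastforce
    have "g ` (P - {c}) = f ` (P - {c})" using gP(1) by (rule image_cong[OF refl])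
    moreover have "g ` Q = {k}" using gQ Q_ne by auto
    ultimately have "g ` (U - {c}) = f ` (P - {c}) \<union> {k}" unfolding U_minus image_Un by simp
    then have "g ` (U - {c}) = {..<Suc k}" using f by (auto simp: lessThan_Suc)
    moreover have "insert c (U - {c}) = U" using Node.prems(2) by auto
    then have "Node U ts = chain_tree c g (Suc k) (U - {c})"
      using chain_tree_cong[of "P - {c}" g f c k] gP(1)
      unfolding chain_tree.simps below at by (simp add: ts rest t'_eq)
    ultimately show ?thesis unfolding ltree.sel by (intro exI conjI)
  qed
qed

lemma label_chain_tree: "f ` A = {..<k} \<Longrightarrow> label (chain_tree c f k A) = insert c A"
  by (cases k) auto

lemma image_below_top:
  assumes "f ` A = {..<Suc k}"
  shows "f ` {x \<in> A. f x < k} = {..<k}"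
proof (intro equalityI subsetI)
  fix i assume "i \<in> {..<k}"
  moreover from this have "i \<in> f ` A" using assms by simp
  ultimately show "i \<in> f ` {x \<in> A. f x < k}" by auto
qed auto

lemma top_level_nonempty:
  assumes "f ` A = {..<Suc k}"
  shows "{x \<in> A. f x = k} \<noteq> {}"
proof -
  have "k \<in> f ` A" using assms by simp
  then show ?thesis by auto
qed

text \<open>
  Surjectivity onto \<open>{..<k}\<close> makes every step attach a vertex, which gives each internal node the
  required second child.
\<close>

lemma centred_tree_chain_tree:
  assumes "finite A" "c \<notin> A" "f ` A = {..<k}"
  shows "centred_tree c (chain_tree c f k A)"
  using assms
proof (induction k arbitrary: A)
  case 0
  then show ?case by (auto simp: centred_tree_def is_leaf_def leaf_labels_Node)
next
  case (Suc k)
  let ?P = "{x \<in> A. f x < k}" and ?Q = "{x \<in> A. f x = k}"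
  let ?t' = "chain_tree c f k ?P"
  let ?t = "chain_tree c f (Suc k) A"
  have fin: "finite ?P" "finite ?Q" using Suc.prems by auto
  have t': "centred_tree c ?t'"
    using Suc.prems image_below_top by (intro Suc.IH) auto
  have lab: "label ?t' = insert c ?P" using Suc.prems(3) by (intro label_chain_tree image_below_top)
  have A: "A = ?P \<union> ?Q"
  proof -
    have "f x < Suc k" if "x \<in> A" for x using Suc.prems(3) that by auto
    then show ?thesis by (auto simp: less_Suc_eq)
  qed
  have "insert c A = insert c ?P \<union> ?Q" using A by auto
  moreover have "insert c ?P \<inter> ?Q = {}" using Suc.prems by auto
  ultimately have "singletons (insert c A) = singletons (insert c ?P) + singletons ?Q"
    using fin by (simp add: mset_set_Union del: insert_iff Un_insert_left)
  moreover have "leaf_labels ?t = singletons (insert c ?P) + singletons ?Q"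
    using t' lab by (simp add: leaf_labels_Node centred_tree_def multiset.map_comp o_def)
  moreover have "label ?t = (\<Union>d \<in> set_mset (children ?t). label d)"
    using fin lab A by auto
  moreover have "card ?Q \<noteq> 0" using fin top_level_nonempty[OF Suc.prems(3)] by simp
  then have "2 \<le> size (children ?t)" by simp
  ultimately show ?case
    using t' fin Suc.prems(1) unfolding centred_tree_def by (auto simp: is_leaf_def)
qed

text \<open>
  The step numbers can be read off from the tree, from the root downwards: the only child whose
  label contains \<open>c\<close> is the subtree of the earlier steps, and the depth of the chain is \<open>k\<close>.
\<close>

lemma chain_tree_inject:
  assumes "finite A" "finite A'" "c \<notin> A" "c \<notin> A'"
    and "f ` A = {..<k}" "f' ` A' = {..<k'}"
    and "chain_tree c f k A = chain_tree c f' k' A'"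
  shows "k = k' \<and> A = A' \<and> (\<forall>x \<in> A. f x = f' x)"
  using assms
proof (induction k arbitrary: k' A A')
  case 0
  then show ?case by (cases k') auto
next
  case (Suc k)
  obtain l where k': "k' = Suc l" using Suc.prems(7) by (cases k') auto
  let ?P = "{x \<in> A. f x < k}" and ?Q = "{x \<in> A. f x = k}"
  let ?P' = "{x \<in> A'. f' x < l}" and ?Q' = "{x \<in> A'. f' x = l}"
  let ?leaves = "\<lambda>Q. image_mset (\<lambda>v. Node {v} {#}) (mset_set Q)"
  note f' = Suc.prems(6)[unfolded k']
  have eq: "add_mset (chain_tree c f k ?P) (?leaves ?Q) =
      add_mset (chain_tree c f' l ?P') (?leaves ?Q')"
    and "insert c A = insert c A'"
    using Suc.prems(7) unfolding k' by simp_all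
  then have A: "A = A'" using insert_ident[OF Suc.prems(3,4)] by simp
  have lab: "c \<in> label (chain_tree c f k ?P)" "c \<in> label (chain_tree c f' l ?P')"
    using label_chain_tree[OF image_below_top[OF Suc.prems(5)], of c]
      label_chain_tree[OF image_below_top[OF f'], of c] by auto
  (* Keeping the children that contain c isolates the subtree of the earlier steps. *)
  have no_centre: "filter_mset (\<lambda>d. c \<in> label d) (?leaves Q) = {#}" if "c \<notin> Q" "finite Q" for Q
    using that by (auto simp: filter_mset_eq_conv)
  have Q: "filter_mset (\<lambda>d. c \<in> label d) (?leaves ?Q) = {#}"
    by (rule no_centre) (use Suc.prems(1-4) in simp_all)
  have Q': "filter_mset (\<lambda>d. c \<in> label d) (?leaves ?Q') = {#}"
    by (rule no_centre) (use Suc.prems(1-4) in simp_all)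
  have sub: "chain_tree c f k ?P = chain_tree c f' l ?P'"
    using arg_cong[OF eq, of "filter_mset (\<lambda>d. c \<in> label d)"] lab by (simp add: Q Q')
  have IH: "k = l \<and> ?P = ?P' \<and> (\<forall>x \<in> ?P. f x = f' x)"
    using Suc.prems(1-4) image_below_top[OF Suc.prems(5)] image_below_top[OF f'] sub
    by (intro Suc.IH) simp_all
  have "f x = f' x" if "x \<in> A" for x
  proof (cases "x \<in> ?P")
    case False
    have "x \<notin> ?P'" and "x \<in> A'" using False IH A that by blast+
    then have "f x \<ge> k" "f' x \<ge> l" using False that by simp_all
    moreover have "f x < Suc k" "f' x < Suc l"
      using imageI[OF that, of f] imageI[OF \<open>x \<in> A'\<close>, of f'] unfolding Suc.prems(5) f' by simp_all
    moreover have "k = l" using IH by blast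
    ultimately show ?thesis by simp
  qed (use IH in blast)
  moreover have "Suc k = k'" using IH k' by blast
  ultimately show ?case using A by blast
qed

section \<open>Connected gluing in the star\<close>

text \<open>
  The leaves below a node carry distinct vertices, so the label is at least as large as the number
  of children. This rules out internal labels of one vertex, which would induce a connected
  subgraph without containing the centre.
\<close>

lemma two_le_card_internal_label:
  assumes "assembly_tree G t" "finite (verts G)" "s \<in># subtrees t" "\<not> is_leaf s"
  shows "2 \<le> card (label s)"
proof -
  have sub: "subtrees s \<subseteq># subtrees t" using assms(3) by (rule subtrees_subtree)
  have t: "\<forall>s \<in># subtrees t. \<not> is_leaf s \<longrightarrow>
      2 \<le> size (children s) \<and> label s = (\<Union>c \<in> set_mset (children s). label c)"
    "leaf_labels t = singletons (verts G)"
    using assms(1) by (auto simp: assembly_tree_def)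
  obtain N where "singletons (verts G) = leaf_labels s + N"
    using leaf_labels_subtree[OF assms(3)] t(2) by (metis subset_mset.le_iff_add)
  with assms(2) obtain P Q where PQ: "verts G = P \<union> Q" and P: "leaf_labels s = singletons P"
    by (rule singletons_eq_plusD)
  have finP: "finite P" using PQ assms(2) by simp
  have "label s = \<Union> (set_mset (leaf_labels s))"
    using t(1) sub by (intro label_eq_Union_leaf_labels) (meson mset_subset_eqD)
  then have "label s = P" using P finP by simp
  then have "card (label s) = size (leaf_labels s)" using P by simp
  moreover have "size (leaf_labels s) \<ge> size (children s)"
  proof (cases s)
    case (Node U ts)
    have "size ts \<le> size (\<Sum>\<^sub># (image_mset leaf_labels ts))"
    proof (induction ts)
      case (add d ts)
      moreover have "size (leaf_labels d) > 0"
        using leaf_labels_nonempty[of d] by (simp add: nonempty_has_size)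
      ultimately show ?case by simp
    qed simp
    then show ?thesis using Node assms(4) by (simp add: leaf_labels_Node is_leaf_def)
  qed
  ultimately show ?thesis using t(1) assms(3,4) by fastforce
qed

lemma connected_induced_star:
  assumes U: "U \<subseteq> {0..<m}" and two: "2 \<le> card U"
  shows "Digraph_Component.connected (with_proj (star_graph m) \<restriction> U) \<longleftrightarrow> 0 \<in> U"
proof -
  let ?H = "mk_symmetric (with_proj (star_graph m) \<restriction> U)"
  have parcs: "parcs ?H = {(u, v). u \<in> U \<and> v \<in> U \<and> u \<noteq> v \<and> (u = 0 \<or> v = 0)}"
  proof (intro equalityI subrelI)
    fix u v assume "(u, v) \<in> {(u, v). u \<in> U \<and> v \<in> U \<and> u \<noteq> v \<and> (u = 0 \<or> v = 0)}"
    then have "(u, v) \<in> arcs (with_proj (star_graph m) \<restriction> U)"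
      using U by (auto simp: star_graph_def)
    then show "(u, v) \<in> parcs ?H" by (force simp: parcs_mk_symmetric)
  qed (auto simp: parcs_mk_symmetric star_graph_def)
  have verts: "pverts ?H = U" by simp
  have wf: "wf_digraph (with_proj ?H)" by unfold_locales (auto simp: parcs verts)
  have ne: "U \<noteq> {}" using two by auto
  show ?thesis
  proof
    assume "0 \<in> U"
    have reach: "u \<rightarrow>\<^sup>*\<^bsub>with_proj ?H\<^esub> v" if "u \<in> U" "v \<in> U" "u = 0 \<or> v = 0" for u v
      using that wf_digraph.reachable_refl[OF wf, of u] 
        wf_digraph.reachable_adjI[OF wf, of u v] by (cases "u = v") (auto simp: parcs)
    then show "Digraph_Component.connected (with_proj (star_graph m) \<restriction> U)"
      unfolding connected_def strongly_connected_def
      using ne \<open>0 \<in> U\<close> by (auto intro: wf_digraph.reachable_trans[OF wf, of _ 0])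
  next
    assume conn: "Digraph_Component.connected (with_proj (star_graph m) \<restriction> U)"
    obtain u v where uv: "u \<in> U" "v \<in> U" "u \<noteq> v"
      using two ne by (metis One_nat_def card.empty card_1_singleton_iff card_le_Suc0_iff_eq 
          card.infinite not_less_eq_eq numeral_2_eq_2 zero_le)
    then have "u \<rightarrow>\<^sup>*\<^bsub>with_proj ?H\<^esub> v"
      using conn by (simp add: connected_def strongly_connected_def)
    then have "parcs ?H \<noteq> {}" using uv(3)
      unfolding reachable_def by (cases rule: rtrancl_on.cases) auto
    then show "0 \<in> U" unfolding parcs by auto
  qed
qed

text \<open>
  For the star, the only graph-theoretic condition left in the gluing rule is membership of the
  centre, so the trees to be counted are described without reference to arcs.
\<close>

lemma connected_assembly_tree_star_iff:
  "assembly_tree (with_proj (star_graph m)) t \<and> connected_gluing (with_proj (star_graph m)) t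
    \<longleftrightarrow> centred_tree 0 t \<and> label t = {0..<m}"
proof -
  let ?G = "with_proj (star_graph m)"
  have verts: "verts ?G = {0..<m}" by (simp add: star_graph_def)
  have conn: "connected_gluing ?G t \<longleftrightarrow> (\<forall>s \<in># subtrees t. \<not> is_leaf s \<longrightarrow> 0 \<in> label s)"
    if "assembly_tree ?G t"
  proof -
    have "Digraph_Component.connected (?G \<restriction> label s) \<longleftrightarrow> 0 \<in> label s"
      if s: "s \<in># subtrees t" "\<not> is_leaf s" for s
    proof (rule connected_induced_star)
      show "label s \<subseteq> {0..<m}"
        using \<open>assembly_tree ?G t\<close> s(1) verts by (auto simp: assembly_tree_def)
      show "2 \<le> card (label s)"
        using \<open>assembly_tree ?G t\<close> s verts
          two_le_card_internal_label[of ?G t s] by simp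
    qed
    then show ?thesis unfolding connected_gluing_def by blast
  qed
  have sub: "label s \<subseteq> label t" if "centred_tree 0 t" "s \<in># subtrees t" for s t
  proof -
    have t: "\<forall>s \<in># subtrees t. \<not> is_leaf s \<longrightarrow> label s = (\<Union>d \<in> set_mset (children s). label d)"
      using that(1) by (auto simp: centred_tree_def)
    then have "\<forall>r \<in># subtrees s. \<not> is_leaf r \<longrightarrow> label r = (\<Union>d \<in> set_mset (children r). label d)"
      using subtrees_subtree[OF that(2)] by (meson mset_subset_eqD)
    then show ?thesis
      using label_eq_Union_leaf_labels[OF t] label_eq_Union_leaf_labels
        set_mset_mono[OF leaf_labels_subtree[OF that(2)]] by (metis Union_mono)
  qed
  show ?thesis
  proof
    assume "assembly_tree ?G t \<and> connected_gluing ?G t"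
    then show "centred_tree 0 t \<and> label t = {0..<m}"
      using conn unfolding assembly_tree_def centred_tree_def verts by (simp del: with_proj_simps)
  next
    assume t: "centred_tree 0 t \<and> label t = {0..<m}"
    then have at: "assembly_tree ?G t"
      using sub unfolding assembly_tree_def verts centred_tree_def by metis
    moreover have "connected_gluing ?G t"
      using t conn[OF at] unfolding centred_tree_def by blast
    ultimately show "assembly_tree ?G t \<and> connected_gluing ?G t" by simp
  qed
qed

section \<open>Counting the trees\<close>

theorem theorem3p1:
  fixes n :: nat
  assumes "n \<ge> 1"
  shows "num_assembly_trees_connected (with_proj (star_graph (n + 1))) =
    (\<Sum>k = 1..n. fact k * Stirling n k)"
proof -
  let ?S = "SIGMA k:{1..n}. surjections {1..n} {..<k}"
  let ?tree = "\<lambda>(k, f). chain_tree 0 f k {1..n}"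
  have verts: "{0..<n + 1} = insert 0 {1..n}" by auto
  have "{t. centred_tree 0 t \<and> label t = insert 0 {1..n}} = ?tree ` ?S" (is "?T = _")
  proof (intro equalityI subsetI)
    fix t assume "t \<in> ?T"
    then have t: "centred_tree 0 t" "label t = insert 0 {1..n}" by auto
    then obtain k f where f: "f ` {1..n} = {..<k}" and tree: "t = chain_tree 0 f k {1..n}"
      using centred_tree_is_chain_tree[of 0 t] by auto
    have "k \<le> n" using card_image_le[of "{1..n}" f] f by simp
    (* A vertex besides the centre exists, so at least one gluing step takes place. *)
    moreover have "k \<noteq> 0" using f assms by (cases k) auto
    moreover have "restrict f {1..n} \<in> surjections {1..n} {..<k}"
      using f by (auto simp: surjections_def)
    moreover have "t = ?tree (k, restrict f {1..n})"
      unfolding tree by (auto intro: chain_tree_cong)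
    ultimately show "t \<in> ?tree ` ?S" by force
  next
    fix t assume "t \<in> ?tree ` ?S"
    then obtain k f where "f ` {1..n} = {..<k}" and tree: "t = chain_tree 0 f k {1..n}"
      by (auto simp: surjections_def)
    then show "t \<in> ?T" by (simp add: centred_tree_chain_tree label_chain_tree)
  qed
  moreover have "inj_on ?tree ?S"
  proof (rule inj_onI, clarify)
    fix k f k' f'
    assume f: "f \<in> surjections {1..n} {..<k}" and f': "f' \<in> surjections {1..n} {..<k'}"
      and eq: "chain_tree 0 f k {1..n} = chain_tree 0 f' k' {1..n}"
    have "k = k' \<and> {1..n} = {1..n} \<and> (\<forall>x \<in> {1..n}. f x = f' x)"
      by (rule chain_tree_inject[OF _ _ _ _ _ _ eq]) (use f f' in \<open>auto simp: surjections_def\<close>)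
    moreover from this have "f = f'" using f f'
      by (intro PiE_ext[of f "{1..n}" "\<lambda>_. {..<k}" f']) (auto simp: surjections_def)
    ultimately show "k = k' \<and> f = f'" by simp
  qed
  ultimately have "num_assembly_trees_connected (with_proj (star_graph (n + 1))) = card ?S"
    unfolding num_assembly_trees_connected_def connected_assembly_tree_star_iff verts
    by (simp add: card_image)
  also have "\<dots> = (\<Sum>k = 1..n. card (surjections {1..n} {..<k}))"
    by (intro card_SigmaI) (simp_all add: finite_surjections)
  also have "\<dots> = (\<Sum>k = 1..n. fact k * Stirling n k)"
    by (simp add: card_surjections)
  finally show ?thesis .
qed

end
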